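(* Let $D\subset\mathbb{C}$ be the unit disk, let $\varphi:\partial D\to\mathbb{R}$ be a bounded function, and let $E_\varphi\subset\partial D$ be its set of discontinuities. Then $E_\varphi$ is of Lebesgue measure zero if and only if it is b-pluripolar.
   Context: A set $F \subset \partial D$ is b-pluripolar if there exists a subharmonic function $v$ on $D$ with $v \le 0$, $v \not\equiv -\infty$, and $v^* = -\infty$ on $F$, where $v^*(\zeta) = \limsup_{D\ni w\to\zeta} v(w)$ for $\zeta\in\partial D$. Lebesgue measure on $\partial D$ is arc length measure. *)

theory Defs
  imports "HOL-Analysis.Analysis"
begin

definition usc_on :: "'a::topological_space set \<Rightarrow> ('a \<Rightarrow> ereal) \<Rightarrow> bool" where
  "usc_on S f \<longleftrightarrow> (\<forall>c. openin (top_of_set S) {x \<in> S. f x < c})"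

(* Mean of f over the circle of centre a and radius r, as the integral of the positive part minus
   that of the negative part (e2ennreal truncates negative values to 0).  The first integral is
   finite if f is bounded above on the circle, so no "\<infinity> - \<infinity>" occurs in the use below. *)
definition circle_mean :: "(complex \<Rightarrow> ereal) \<Rightarrow> complex \<Rightarrow> real \<Rightarrow> ereal" where
  "circle_mean f a r =
     (enn2ereal (\<integral>\<^sup>+t\<in>{0..2*pi}. e2ennreal (f (a + of_real r * cis t)) \<partial>lborel)
      - enn2ereal (\<integral>\<^sup>+t\<in>{0..2*pi}. e2ennreal (- f (a + of_real r * cis t)) \<partial>lborel))
     / ereal (2 * pi)"

(* The function that is identically -\<infinity> is allowed; b_pluripolar excludes it explicitly. *)
definition subharmonic_on :: "complex set \<Rightarrow> (complex \<Rightarrow> ereal) \<Rightarrow> bool" where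
  "subharmonic_on D v \<longleftrightarrow>
     usc_on D v \<and> (\<forall>z\<in>D. v z < \<infinity>) \<and>
     (\<forall>a r. r > 0 \<and> cball a r \<subseteq> D \<longrightarrow> v a \<le> circle_mean v a r)"

definition b_pluripolar :: "complex set \<Rightarrow> complex set \<Rightarrow> bool" where
  "b_pluripolar D F \<longleftrightarrow> F \<subseteq> frontier D \<and>
     (\<exists>v. subharmonic_on D v \<and> (\<forall>z\<in>D. v z \<le> 0) \<and> (\<exists>z\<in>D. v z \<noteq> -\<infinity>) \<and>
          (\<forall>\<zeta>\<in>F. Limsup (at \<zeta> within D) v = -\<infinity>))"

(* Arc length on the unit circle, completed so that all subsets of Borel null sets are
   measurable. *)
definition circle_lebesgue :: "complex measure" where
  "circle_lebesgue =
     completion (distr (restrict_space lborel {0..<2*pi}) (restrict_space borel (sphere 0 1)) cis)"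

definition discontinuities :: "'a::t2_space set \<Rightarrow> ('a \<Rightarrow> 'b::topological_space) \<Rightarrow> 'a set"
  where "discontinuities S f = {x \<in> S. \<not> continuous (at x within S) f}"

end

(* A null set has angles covered infinitely often by intervals |\<theta> - t_j| < d_j with \<Sum> d_j < \<infinity>.  The
   Poisson kernel with pole (1 + d_j) cis t_j, scaled by 4 d_j, is harmonic across the unit circle,
   exceeds 1 near the corresponding arc and has value 4 d_j at the origin; minus the sum of these
   kernels is the required subharmonic function.

   Conversely, if v tends to -\<infinity> at F then v \<le> -M on U \<inter> D for some open U \<supseteq> F.  For a compact set T
   of angles of points of U, the mean of the Poisson kernels with poles R cis t, t \<in> T, is at most 1
   and tends to 0 off U as R \<down> 1, so the maximum principle bounds M times its value at a by -v(a).
   That value is at least a constant (depending on a) times |T|, so the arc length of U is O(1/M).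
   Comparing at a directly allows v(0) = -\<infinity>. *)
theory Submission
  imports Defs "HOL-Complex_Analysis.Cauchy_Integral_Formula"
begin

subsection \<open>The Poisson kernel\<close>

text \<open>Cauchy's integral formula at the centre: on the parametrised circle the factor
  \<open>1 / (z - a)\<close> cancels the derivative of the path up to \<open>\<i>\<close>, and
  \<open>Im (\<i> * f)\<close> is \<open>Re f\<close>.\<close>

lemma circle_integral_Re_holomorphic:
  assumes f: "f holomorphic_on cball a r" and r: "r > 0"
  shows "(LINT s:{0..2*pi}|lborel. Re (f (a + of_real r * cis s))) = 2 * pi * Re (f a)"
proof -
  have on_cball: "a + of_real r * cis s \<in> cball a r" for s
    using r by (simp add: dist_norm norm_mult)
  have "((\<lambda>u. f u / (u - a)) has_contour_integral 2 * of_real pi * \<i> * f a) (circlepath a r)"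
    using f r by (intro Cauchy_integral_circlepath_simple) auto
  hence "((\<lambda>s. f (a + r * cis s) / (a + r * cis s - a) * r * \<i> * cis s)
            has_integral (2 * of_real pi * \<i> * f a)) {0..2*pi}"
    unfolding circlepath_def by (subst (asm) has_contour_integral_part_circlepath_iff) auto
  also have "(\<lambda>s. f (a + r * cis s) / (a + r * cis s - a) * r * \<i> * cis s)
      = (\<lambda>s. \<i> * f (a + r * cis s))"
    using r by (auto simp: fun_eq_iff)
  finally have "((\<lambda>s. \<i> * f (a + r * cis s)) has_integral (2 * of_real pi * \<i> * f a)) {0..2*pi}" .
  hence "((\<lambda>s. Im (\<i> * f (a + r * cis s))) has_integral Im (2 * of_real pi * \<i> * f a)) {0..2*pi}"
    by (rule has_integral_Im)
  hence int: "((\<lambda>s. Re (f (a + r * cis s))) has_integral 2 * pi * Re (f a)) {0..2*pi}"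
    by simp
  have "continuous_on {0..2*pi} (\<lambda>s. Re (f (a + r * cis s)))"
    using on_cball
    by (intro continuous_intros continuous_on_compose2[OF holomorphic_on_imp_continuous_on[OF f]]) auto
  hence "set_integrable lborel {0..2*pi} (\<lambda>s. Re (f (a + r * cis s)))"
    by (rule borel_integrable_atLeastAtMost')
  from set_borel_integral_eq_integral(2)[OF this] int show ?thesis
    by (simp add: integral_unique)
qed

text \<open>The Poisson kernel with pole \<open>R * cis t\<close>, in Herglotz form: as the real
  part of a function holomorphic away from the pole it inherits the mean value property. For
  \<open>R > 1\<close> the pole lies outside the closed disk.\<close>

definition poisson :: "real \<Rightarrow> real \<Rightarrow> complex \<Rightarrow> real" where
  "poisson R t z = Re ((of_real R * cis t + z) / (of_real R * cis t - z))"

lemma poisson_eq: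
  "poisson R t z = (R\<^sup>2 - (norm z)\<^sup>2) / (norm (of_real R * cis t - z))\<^sup>2"
proof -
  define w where "w = of_real R * cis t"
  have w: "(norm w)\<^sup>2 = R\<^sup>2"
    by (simp add: w_def norm_mult)
  have "poisson R t z = Re ((w + z) * cnj (w - z)) / (norm (w - z))\<^sup>2"
    unfolding poisson_def w_def[symmetric] by (subst complex_div_cnj) (simp add: Re_divide_of_real flip: of_real_power)
  also have "Re ((w + z) * cnj (w - z)) = (norm w)\<^sup>2 - (norm z)\<^sup>2"
    by (simp only: cmod_power2) (simp add: algebra_simps power2_eq_square)
  finally show ?thesis
    unfolding w_def[symmetric] w .
qed

lemma poisson_denominator_nz:
  assumes "norm z < R" shows "of_real R * cis t - z \<noteq> 0"
proof
  assume "of_real R * cis t - z = 0"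
  hence "norm z = norm (of_real R * cis t)" by simp
  thus False using assms by (simp add: norm_mult abs_if split: if_splits)
qed

lemma poisson_pos: "norm z < R \<Longrightarrow> poisson R t z > 0"
  using poisson_denominator_nz[of z R t]
  by (auto simp: poisson_eq intro!: divide_pos_pos power_strict_mono)

lemma poisson_0: "R > 0 \<Longrightarrow> poisson R t 0 = 1"
  by (simp add: poisson_eq norm_mult power_mult_distrib)

text \<open>Harnack's lower bound: the pole is at distance at most \<open>R + norm z\<close> from
  \<open>z\<close>.\<close>

lemma poisson_lower:
  assumes "norm z < R" shows "poisson R t z \<ge> (R - norm z) / (R + norm z)"
proof -
  have R: "R > 0" using assms norm_ge_zero[of z] by linarith
  have "norm (of_real R * cis t - z) \<le> R + norm z"
    using norm_triangle_ineq4[of "of_real R * cis t" z] R by (simp add: norm_mult)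
  hence "(R\<^sup>2 - (norm z)\<^sup>2) / (norm (of_real R * cis t - z))\<^sup>2 \<ge> (R\<^sup>2 - (norm z)\<^sup>2) / (R + norm z)\<^sup>2"
    using assms R poisson_denominator_nz[OF assms, of t]
    by (intro divide_left_mono power_mono mult_pos_pos zero_less_power) (auto simp: power_mono add_pos_nonneg)
  moreover have "(R\<^sup>2 - (norm z)\<^sup>2) / (R + norm z)\<^sup>2 = (R - norm z) / (R + norm z)"
    using R norm_ge_zero[of z] by (simp add: divide_simps power2_eq_square square_diff_square_factored add_nonneg_eq_0_iff)
  ultimately show ?thesis by (simp add: poisson_eq)
qed

lemma continuous_on_poisson_pair:
  assumes "\<And>p. p \<in> S \<Longrightarrow> norm (fst p) < R"
  shows "continuous_on S (\<lambda>p. poisson R (snd p) (fst p))"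
proof -
  have "of_real R * cis (snd p) - fst p \<noteq> 0" if "p \<in> S" for p
    using poisson_denominator_nz assms that by blast
  thus ?thesis unfolding poisson_def by (intro continuous_intros) auto
qed

lemma continuous_on_poisson:
  assumes "\<And>z. z \<in> S \<Longrightarrow> norm z < R"
  shows "continuous_on S (poisson R t)"
  using continuous_on_compose2[OF continuous_on_poisson_pair[of "S \<times> {t}" R], of S "\<lambda>z. (z, t)"] assms
  by (auto simp: image_subset_iff continuous_on_Pair)

lemma continuous_on_poisson_angle:
  assumes "norm z < R"
  shows "continuous_on A (\<lambda>t. poisson R t z)"
  using continuous_on_compose2[OF continuous_on_poisson_pair[of "{z} \<times> A" R], of A "\<lambda>t. (z, t)"] assms
  by (auto simp: image_subset_iff continuous_on_Pair)

lemma cball_subset_unit_ballD: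
  assumes "cball a r \<subseteq> ball 0 1" "r > 0"
  shows "a + of_real r * cis s \<in> ball (0::complex) 1" "a \<in> ball 0 1"
proof -
  have "a + of_real r * cis s \<in> cball a r" "a \<in> cball a r"
    using assms by (auto simp: dist_norm norm_mult)
  thus "a + of_real r * cis s \<in> ball (0::complex) 1" "a \<in> ball 0 1"
    using assms(1) by blast+
qed

lemma poisson_mean:
  assumes "cball a r \<subseteq> ball 0 1" "r > 0" "R \<ge> 1"
  shows "(LINT s:{0..2*pi}|lborel. poisson R t (a + of_real r * cis s)) = 2 * pi * poisson R t a"
proof -
  have "of_real R * cis t - z \<noteq> 0" if "z \<in> cball a r" for z
    using assms that by (intro poisson_denominator_nz) (force simp: subset_iff)
  hence "(\<lambda>z. (of_real R * cis t + z) / (of_real R * cis t - z)) holomorphic_on cball a r"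
    by (intro holomorphic_intros) auto
  from circle_integral_Re_holomorphic[OF this \<open>r > 0\<close>] show ?thesis
    by (simp add: poisson_def)
qed

text \<open>Here the pole moves and \<open>z\<close> is fixed. Dividing numerator and denominator by
  \<open>cis t\<close> and conjugating, which keeps the real part, gives a function of
  \<open>w = cis t\<close> that is holomorphic on the closed unit disk and equals 1 at its
  centre.\<close>

lemma poisson_integral_angle:
  assumes "norm z < R"
  shows "(LINT t:{0..2*pi}|lborel. poisson R t z) = 2 * pi"
proof -
  have R: "R > 0" using assms norm_ge_zero[of z] by linarith
  have nz: "of_real R - cnj z * w \<noteq> 0" if "w \<in> cball 0 1" for w
  proof
    assume "of_real R - cnj z * w = 0"
    hence "norm (of_real R :: complex) = norm (cnj z * w)" by simp
    also have "\<dots> = norm z * norm w" by (simp add: norm_mult)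
    also have "\<dots> \<le> norm z * 1" using that by (intro mult_left_mono) auto
    finally show False using assms R by simp
  qed
  hence "(\<lambda>w. (of_real R + cnj z * w) / (of_real R - cnj z * w)) holomorphic_on cball 0 1"
    by (intro holomorphic_intros) auto
  from circle_integral_Re_holomorphic[OF this]
  have "(LINT t:{0..2*pi}|lborel. Re ((of_real R + cnj z * cis t) / (of_real R - cnj z * cis t))) = 2 * pi"
    using R by simp
  moreover have "Re ((of_real R + cnj z * cis t) / (of_real R - cnj z * cis t)) = poisson R t z" for t
  proof -
    have "(of_real R * cis t + z) / (of_real R * cis t - z)
        = (cis t * (of_real R + z * cnj (cis t))) / (cis t * (of_real R - z * cnj (cis t)))"
      by (simp add: algebra_simps cis_cnj cis_mult)
    also have "\<dots> = cnj ((of_real R + cnj z * cis t) / (of_real R - cnj z * cis t))"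
      by (simp add: mult_ac del: cis_cnj)
    finally show ?thesis
      unfolding poisson_def by (simp only: cnj.sel)
  qed
  ultimately show ?thesis by simp
qed

section \<open>Means of Poisson kernels over a compact set of poles\<close>

lemma set_integrable_const_compact:
  fixes T :: "'a::euclidean_space set"
  assumes "compact T" shows "set_integrable lborel T (\<lambda>_. c :: real)"
  unfolding set_integrable_def by (intro borel_integrable_compact assms continuous_intros)

lemma measure_le_2pi:
  assumes "compact T" "T \<subseteq> {0..2*pi}" shows "measure lborel T \<le> 2 * pi"
proof -
  have "measure lborel T \<le> measure lborel {0..2*pi}"
    using assms by (intro measure_mono_fmeasurable) (auto simp: borel_compact fmeasurable_def)
  thus ?thesis by simp
qed

text \<open>For \<open>R\<close> close to 1, a smoothed harmonic measure of the part of the circle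
  with angles in \<open>T\<close>. Dividing by \<open>2 * pi\<close> rather than by the measure of
  \<open>T\<close> gives the full circle the value 1.\<close>

definition poisson_mass :: "real \<Rightarrow> real set \<Rightarrow> complex \<Rightarrow> real" where
  "poisson_mass R T z = (LINT t:T|lborel. poisson R t z) / (2 * pi)"

context
  fixes R :: real and T :: "real set"
  assumes R: "R > 1" and T: "compact T" "T \<subseteq> {0..2*pi}"
begin

lemma set_integrable_poisson:
  assumes "norm z < R" shows "set_integrable lborel T (\<lambda>t. poisson R t z)"
  unfolding set_integrable_def
  by (intro borel_integrable_compact T continuous_on_poisson_angle assms)

text \<open>The kernels are positive, so enlarging \<open>T\<close> to the whole period only
  increases the integral.\<close>

lemma poisson_mass_le_1:
  assumes "norm z < R" shows "poisson_mass R T z \<le> 1"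
proof -
  have "(LINT t:T|lborel. poisson R t z) \<le> (LINT t:{0..2*pi}|lborel. poisson R t z)"
    unfolding set_lebesgue_integral_def
    using T poisson_pos[OF assms] set_integrable_poisson[OF assms]
      borel_integrable_atLeastAtMost'[OF continuous_on_poisson_angle[OF assms], of 0 "2*pi"]
    by (intro integral_mono) (auto simp: set_integrable_def indicator_def less_imp_le)
  thus ?thesis
    using poisson_integral_angle[OF assms] by (simp add: poisson_mass_def)
qed

lemma poisson_mass_upper:
  assumes "norm z < R" "\<And>t. t \<in> T \<Longrightarrow> poisson R t z \<le> c" "c \<ge> 0"
  shows "poisson_mass R T z \<le> c"
proof -
  have "(LINT t:T|lborel. poisson R t z) \<le> (LINT t:T|lborel. c)"
    using assms by (intro set_integral_mono set_integrable_poisson set_integrable_const_compact T)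
  also have "\<dots> = c * measure lborel T"
    using T by (simp add: set_lebesgue_integral_def borel_compact)
  also have "\<dots> \<le> c * (2 * pi)"
    using assms by (intro mult_left_mono measure_le_2pi T)
  finally show ?thesis by (simp add: poisson_mass_def field_simps)
qed

text \<open>Harnack's bound integrated over \<open>T\<close>. The quotient
  \<open>(R - norm z) / (R + norm z)\<close> grows with \<open>R\<close>, so its value at
  \<open>R = 1\<close> yields a bound independent of \<open>R\<close>.\<close>

lemma poisson_mass_lower:
  assumes "norm z < 1"
  shows "poisson_mass R T z \<ge> measure lborel T * ((1 - norm z) / (1 + norm z)) / (2 * pi)"
proof -
  have "(1 - norm z) / (1 + norm z) \<le> (R - norm z) / (R + norm z)"
  proof (subst frac_le_eq)
    have "norm z * 1 \<le> norm z * R"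
      using R by (intro mult_left_mono) auto
    thus "((1 - norm z) * (R + norm z) - (R - norm z) * (1 + norm z)) / ((1 + norm z) * (R + norm z)) \<le> 0"
      using R norm_ge_zero[of z] by (intro divide_nonpos_nonneg) (auto simp: algebra_simps)
    show "1 + norm z \<noteq> 0" "R + norm z \<noteq> 0"
      using R norm_ge_zero[of z] by linarith+
  qed
  hence *: "(1 - norm z) / (1 + norm z) \<le> poisson R t z" for t
    using poisson_lower[of z R t] assms R by linarith
  have "(LINT t:T|lborel. (1 - norm z) / (1 + norm z)) \<le> (LINT t:T|lborel. poisson R t z)"
    using assms R * by (intro set_integral_mono set_integrable_poisson set_integrable_const_compact T) auto
  moreover have "(LINT t:T|lborel. (1 - norm z) / (1 + norm z))
      = measure lborel T * ((1 - norm z) / (1 + norm z))"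
    using T by (simp add: set_lebesgue_integral_def borel_compact)
  ultimately show ?thesis
    unfolding poisson_mass_def by (intro divide_right_mono) auto
qed

text \<open>The kernel is uniformly continuous on the compact product of the closed disk and
  \<open>T\<close>. Continuity up to the circle serves the boundary comparison in
  \<open>angle_measure_le\<close>.\<close>

lemma continuous_on_poisson_mass: "continuous_on (cball 0 1) (poisson_mass R T)"
proof -
  have "uniformly_continuous_on (cball 0 1 \<times> T) (\<lambda>p. poisson R (snd p) (fst p))"
    using R T by (intro compact_uniformly_continuous continuous_on_poisson_pair compact_Times) auto
  note uc = this[unfolded uniformly_continuous_on_def, rule_format]
  show ?thesis
    unfolding continuous_on_iff
  proof (intro ballI allI impI)
    fix z :: complex and e :: real assume z: "z \<in> cball 0 1" and e: "e > 0"
    from uc[of "e/2"] e obtain d where d: "d > 0"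
      and *: "\<And>p q. p \<in> cball 0 1 \<times> T \<Longrightarrow> q \<in> cball 0 1 \<times> T \<Longrightarrow> dist q p < d \<Longrightarrow>
               dist (poisson R (snd q) (fst q)) (poisson R (snd p) (fst p)) < e/2" by auto
    have "dist (poisson_mass R T z') (poisson_mass R T z) < e"
      if z': "z' \<in> cball 0 1" "dist z' z < d" for z'
    proof -
      have zz: "norm z < R" "norm z' < R" using z z' R by auto
      have "(LINT t:T|lborel. poisson R t z') - (LINT t:T|lborel. poisson R t z)
            = (LINT t:T|lborel. poisson R t z' - poisson R t z)"
        using zz by (intro set_integral_diff(2)[symmetric] set_integrable_poisson)
      also have "norm \<dots> \<le> (LINT t:T|lborel. norm (poisson R t z' - poisson R t z))"
        using zz by (intro set_integral_norm_bound set_integral_diff set_integrable_poisson)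
      also have "\<dots> \<le> (LINT t:T|lborel. e/2)"
      proof (intro set_integral_mono)
        fix t assume "t \<in> T"
        thus "norm (poisson R t z' - poisson R t z) \<le> e/2"
          using *[of "(z,t)" "(z',t)"] z z' by (auto simp: dist_Pair_Pair dist_norm)
      next
        show "set_integrable lborel T (\<lambda>t. norm (poisson R t z' - poisson R t z))"
          using zz by (intro set_integrable_norm set_integral_diff set_integrable_poisson)
        show "set_integrable lborel T (\<lambda>t. e / 2)"
          by (rule set_integrable_const_compact[OF T(1)])
      qed
      also have "\<dots> = e/2 * measure lborel T"
        using T by (simp add: set_lebesgue_integral_def borel_compact)
      also have "\<dots> \<le> e/2 * (2 * pi)"
        using e by (intro mult_left_mono measure_le_2pi T) auto
      finally have "dist (poisson_mass R T z') (poisson_mass R T z) \<le> e / 2"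
        by (simp add: poisson_mass_def dist_real_def field_simps flip: diff_divide_distrib)
      thus ?thesis using e by linarith
    qed
    thus "\<exists>d>0. \<forall>z'\<in>cball 0 1. dist z' z < d \<longrightarrow> dist (poisson_mass R T z') (poisson_mass R T z) < e"
      using d by blast
  qed
qed

text \<open>Fubini reduces this to the mean value property of each single kernel; compactness of the
  product of the two parameter sets gives integrability.\<close>

lemma poisson_mass_mean:
  assumes "cball a r \<subseteq> ball 0 1" "r > 0"
  shows "(LINT s:{0..2*pi}|lborel. poisson_mass R T (a + of_real r * cis s)) = 2 * pi * poisson_mass R T a"
proof -
  define S where "S = {0..2*pi}"
  define c where "c s = a + of_real r * cis s" for s
  have cR: "norm (c s) < R" for s
    using cball_subset_unit_ballD(1)[OF assms, of s] R by (simp add: c_def)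
  have cont: "continuous_on (S \<times> T) (\<lambda>p. poisson R (snd p) (c (fst p)))"
  proof (rule continuous_on_compose2[OF continuous_on_poisson_pair[of "range c \<times> UNIV" R], 
        of _ "\<lambda>p. (c (fst p), snd p)", simplified])
    show "continuous_on (S \<times> T) (\<lambda>p. (c (fst p), snd p))"
      unfolding c_def by (intro continuous_intros)
  qed (use cR in auto)
  have "integrable lborel (\<lambda>p. indicator (S \<times> T) p *\<^sub>R poisson R (snd p) (c (fst p)))"
    by (intro borel_integrable_compact cont compact_Times T) (auto simp: S_def)
  hence "integrable (lborel \<Otimes>\<^sub>M lborel) (\<lambda>(s, t). indicator S s *\<^sub>R indicator T t *\<^sub>R poisson R t (c s))"
    by (simp add: lborel_prod case_prod_unfold indicator_times mult.assoc)
  from lborel_pair.Fubini_integral[OF this]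
  have "(LINT s:S|lborel. LINT t:T|lborel. poisson R t (c s)) = (LINT t:T|lborel. LINT s:S|lborel. poisson R t (c s))"
    by (simp add: set_lebesgue_integral_def mult.left_commute flip: integral_mult_right_zero)
  also have "\<dots> = (LINT t:T|lborel. 2 * pi * poisson R t a)"
    using poisson_mean[OF assms, of R] R by (simp add: S_def c_def)
  finally show ?thesis
    by (simp add: poisson_mass_def c_def S_def set_integral_divide_zero)
qed

end

subsection \<open>The maximum principle\<close>

text \<open>A real \<open>q\<close> strictly between \<open>v z\<close> and \<open>c - k z\<close>
  splits the inequality into \<open>v z < q\<close> and \<open>q + k z < c\<close>, so the sublevel
  set is a union of intersections of two open sets. This also covers
  \<open>v z = -\<infinity>\<close>.\<close>

lemma usc_on_add_continuous:
  fixes k :: "'a::topological_space \<Rightarrow> real"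
  assumes v: "usc_on S v" and k: "continuous_on S k"
  shows "usc_on S (\<lambda>z. v z + ereal (k z))"
  unfolding usc_on_def
proof
  fix c
  have "{z \<in> S. v z + ereal (k z) < c} = (\<Union>q. {z \<in> S. v z < ereal q} \<inter> {z \<in> S. ereal (q + k z) < c})"
  proof safe
    fix z assume "z \<in> S" and *: "v z + ereal (k z) < c"
    hence "v z < c - ereal (k z)"
      by (cases "v z"; cases c) auto
    then obtain q where q: "v z < ereal q" "ereal q < c - ereal (k z)"
      using ereal_dense2 by blast
    from q(2) have "ereal (q + k z) < c"
      by (cases c) auto
    with q(1) \<open>z \<in> S\<close> show "z \<in> (\<Union>q. {z \<in> S. v z < ereal q} \<inter> {z \<in> S. ereal (q + k z) < c})" by blast
  next
    fix z q assume "v z < ereal q" "ereal (q + k z) < c"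
    thus "v z + ereal (k z) < c"
      by (cases "v z"; cases c) auto
  qed
  moreover have "openin (top_of_set S) {z \<in> S. ereal (q + k z) < c}" for q
  proof (cases c)
    case (real c')
    have "openin (top_of_set S) (S \<inter> (\<lambda>z. q + k z) -` {..<c'})"
      by (intro continuous_openin_preimage_gen continuous_intros k)
    thus ?thesis using real by (simp add: vimage_def Int_def)
  qed simp_all
  ultimately show "openin (top_of_set S) {z \<in> S. v z + ereal (k z) < c}"
    using v unfolding usc_on_def by (auto intro!: openin_Union openin_Int)
qed

text \<open>Without a maximum the open sets \<open>g < g y\<close> with \<open>y \<in> K\<close>
  would cover \<open>K\<close>. In a finite subcover, the \<open>y\<close> with the largest value
  \<open>g y\<close> is left uncovered.\<close>

lemma usc_on_attains_max:
  assumes g: "usc_on S g" and K: "compact K" "K \<subseteq> S" "K \<noteq> {}"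
  shows "\<exists>a\<in>K. \<forall>x\<in>K. g x \<le> g a"
proof (rule ccontr)
  assume neg: "\<not> (\<exists>a\<in>K. \<forall>x\<in>K. g x \<le> g a)"
  have "\<exists>O'. open O' \<and> {x \<in> S. g x < c} = S \<inter> O'" for c
    using g unfolding usc_on_def openin_open by blast
  then obtain U where U: "\<And>c. open (U c)" "\<And>c. {x \<in> S. g x < c} = S \<inter> U c" by metis
  have "K \<subseteq> (\<Union>y\<in>K. U (g y))"
  proof
    fix x assume "x \<in> K"
    then obtain y where "y \<in> K" "g x < g y" using neg by (auto simp: not_le)
    thus "x \<in> (\<Union>y\<in>K. U (g y))" using U(2)[of "g y"] K \<open>x \<in> K\<close> by blast
  qed
  then obtain Y where Y: "Y \<subseteq> K" "finite Y" "K \<subseteq> (\<Union>y\<in>Y. U (g y))"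
    using compactE_image[OF K(1), of K "\<lambda>y. U (g y)"] U(1) by metis
  hence "Y \<noteq> {}" using K by auto
  then obtain y where y: "y \<in> Y" "\<And>x. x \<in> Y \<Longrightarrow> g x \<le> g y"
  proof -
    have "Max (g ` Y) \<in> g ` Y" using Y(2) \<open>Y \<noteq> {}\<close> by (intro Max_in) auto
    then obtain y where "y \<in> Y" "Max (g ` Y) = g y" by auto
    thus ?thesis using that[of y] Y(2) by (metis Max_ge finite_imageI imageI)
  qed
  obtain y' where "y' \<in> Y" "y \<in> U (g y')" using y Y by blast
  hence "g y < g y'" using U(2)[of "g y'"] y(1) Y(1) K(2) by blast
  with y(2)[OF \<open>y' \<in> Y\<close>] show False by simp
qed

section \<open>Circle means and comparison with a harmonic function\<close>

text \<open>\<open>f\<close> may change sign: \<open>ennreal\<close> truncates negative values to 0,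
  so the right-hand side integrates the positive part of \<open>f\<close>.\<close>

lemma ennreal_integral_le_nn_integral:
  fixes f :: "'a \<Rightarrow> real"
  assumes "integrable M f"
  shows "ennreal (integral\<^sup>L M f) \<le> (\<integral>\<^sup>+x. ennreal (f x) \<partial>M)"
proof -
  have "ennreal (integral\<^sup>L M f) \<le> ennreal (integral\<^sup>L M (\<lambda>x. max 0 (f x)))"
    using assms by (intro ennreal_leI integral_mono) auto
  also have "\<dots> = (\<integral>\<^sup>+x. ennreal (max 0 (f x)) \<partial>M)"
    using assms by (intro nn_integral_eq_integral[symmetric]) auto
  also have "\<dots> = (\<integral>\<^sup>+x. ennreal (f x) \<partial>M)"
    by (intro nn_integral_cong) (auto simp: max_def ennreal_neg)
  finally show ?thesis .
qed

text \<open>For \<open>v \<le> 0\<close> the first integral in \<open>circle_mean\<close> vanishes,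
  and the submean inequality becomes a bound on the integral of \<open>- v\<close>. If
  \<open>v a = -\<infinity>\<close>, the bound is infinite.\<close>

lemma subharmonic_nonpos_mean:
  assumes v: "subharmonic_on D v" "\<And>z. z \<in> D \<Longrightarrow> v z \<le> 0" and r: "r > 0" "cball a r \<subseteq> D"
  shows "enn2ereal (\<integral>\<^sup>+t\<in>{0..2*pi}. e2ennreal (- v (a + of_real r * cis t)) \<partial>lborel) \<le> ereal (2 * pi) * (- v a)"
proof -
  define I where "I = (\<integral>\<^sup>+t\<in>{0..2*pi}. e2ennreal (- v (a + of_real r * cis t)) \<partial>lborel)"
  have "a + of_real r * cis t \<in> cball a r" for t
    using r by (simp add: dist_norm norm_mult)
  hence "e2ennreal (v (a + of_real r * cis t)) = 0" for t
    using v(2) r(2) by (meson e2ennreal_neg subsetD)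
  hence "circle_mean v a r = (0 - enn2ereal I) / ereal (2 * pi)"
    by (simp add: circle_mean_def I_def zero_ennreal.rep_eq)
  hence "v a \<le> (0 - enn2ereal I) / ereal (2 * pi)"
    using v(1) r unfolding subharmonic_on_def by metis
  moreover have "enn2ereal I \<ge> 0" by simp
  moreover have "v a \<le> 0" using v(2)[of a] r by (simp add: subset_iff)
  ultimately have "enn2ereal I \<le> ereal (2 * pi) * (- v a)"
  proof (cases "v a = -\<infinity>")
    case True
    thus ?thesis by simp
  next
    case False
    then obtain w where w: "v a = ereal w" using \<open>v a \<le> 0\<close> by (cases "v a") auto
    with \<open>v a \<le> (0 - enn2ereal I) / ereal (2 * pi)\<close> obtain i where i: "enn2ereal I = ereal i"
      using \<open>enn2ereal I \<ge> 0\<close> by (cases "enn2ereal I") auto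
    have "w \<le> (- i) / (2 * pi)"
      using \<open>v a \<le> (0 - enn2ereal I) / ereal (2 * pi)\<close> w i by simp
    hence "w * (2 * pi) \<le> - i"
      by (subst (asm) pos_le_divide_eq) auto
    thus ?thesis using w i by (simp add: mult.commute)
  qed
  thus ?thesis unfolding I_def .
qed

text \<open>Expanding the square leaves, besides constants, the real part of a holomorphic function
  that vanishes at the centre.\<close>

lemma integral_norm_power2_circle:
  assumes "r > 0"
  shows "(LINT s:{0..2*pi}|lborel. (norm (a + of_real r * cis s))\<^sup>2) = 2 * pi * ((norm a)\<^sup>2 + r\<^sup>2)"
proof -
  have eq: "(norm (a + of_real r * cis s))\<^sup>2 = Re (of_real ((norm a)\<^sup>2 + r\<^sup>2) + 2 * cnj a * (a + of_real r * cis s - a))" for s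
  proof -
    define w where "w = of_real r * cis s"
    have w: "(norm w)\<^sup>2 = r\<^sup>2" by (simp add: w_def norm_mult)
    have "(norm (a + w))\<^sup>2 = (norm a)\<^sup>2 + (norm w)\<^sup>2 + 2 * Re (cnj a * w)"
      unfolding cmod_power2 by (simp add: power2_eq_square algebra_simps)
    thus ?thesis unfolding w_def[symmetric] w by simp
  qed
  show ?thesis
    unfolding eq using assms by (subst circle_integral_Re_holomorphic) (auto intro!: holomorphic_intros)
qed

text \<open>A positive value of \<open>v + k\<close> would survive a small perturbation that makes
  the sum strictly subharmonic. The boundary condition confines positive values to a compact subset
  of the open disk, where upper semicontinuity yields a maximum, contradicting strictness.\<close>

lemma subharmonic_maximum_principle:
  assumes v: "subharmonic_on (ball 0 1) v" "\<And>z. z \<in> ball 0 1 \<Longrightarrow> v z \<le> 0"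
    and k: "continuous_on (ball 0 1) k"
    and mean: "\<And>a r. r > 0 \<Longrightarrow> cball a r \<subseteq> ball 0 1 \<Longrightarrow>
                 (LINT s:{0..2*pi}|lborel. k (a + of_real r * cis s)) = 2 * pi * k a"
    and bd: "\<And>\<zeta>. \<zeta> \<in> sphere 0 1 \<Longrightarrow> \<exists>N. open N \<and> \<zeta> \<in> N \<and> (\<forall>z\<in>N \<inter> ball 0 1. v z + ereal (k z) \<le> 0)"
    and b: "b \<in> ball 0 1"
  shows "v b + ereal (k b) \<le> 0"
proof (rule ccontr)
  assume "\<not> v b + ereal (k b) \<le> 0"
  hence pos: "v b + ereal (k b) > 0" by simp
  then obtain q where "0 < ereal q" "ereal q < v b + ereal (k b)" using ereal_dense2 by blast
  then have q: "q > 0" "ereal q < v b + ereal (k b)" by auto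
  \<comment> \<open>The term q |z|^2 makes the mean value inequality strict, so that an interior maximum is impossible.\<close>
  define k' where "k' z = k z - q * (1 - (norm z)\<^sup>2)" for z
  define g where "g z = v z + ereal (k' z)" for z
  have k'_le: "k' z \<le> k z" if "z \<in> ball 0 1" for z
    using that q by (auto simp: k'_def power_le_one)
  have gb: "g b > 0"
  proof -
    \<comment> \<open>The perturbation is at most \<open>q\<close> at \<open>b\<close>, and
      \<open>q\<close> was chosen below the supposed positive value there.\<close>
    have "k b \<le> k' b + q" using q by (simp add: k'_def algebra_simps)
    thus ?thesis using q v(2)[OF b] unfolding g_def by (cases "v b") auto
  qed
  have k'_cont: "continuous_on (ball 0 1) k'"
    unfolding k'_def by (intro continuous_intros k)
  have g_usc: "usc_on (ball 0 1) g"
    using usc_on_add_continuous[OF _ k'_cont] v(1) unfolding g_def subharmonic_on_def by blast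
  \<comment> \<open>\<open>G\<close> collects all the good neighbourhoods and covers the circle, so
    its complement \<open>K\<close> in the closed disk is compact and lies in the open disk.\<close>
  define G where "G = \<Union>{N. open N \<and> (\<forall>z\<in>N \<inter> ball 0 1. v z + ereal (k z) \<le> 0)}"
  define K where "K = cball 0 1 - G"
  have "open G" unfolding G_def by (intro open_Union) auto
  hence K: "compact K" unfolding K_def by (intro compact_diff) auto
  have "sphere 0 1 \<subseteq> G" using bd unfolding G_def by blast
  hence K_sub: "K \<subseteq> ball 0 1" unfolding K_def by (auto simp: subset_iff less_le)
  have outside: "g z \<le> 0" if "z \<in> ball 0 1" "z \<notin> K" for z
  proof -
    have "v z + ereal (k z) \<le> 0" using that unfolding K_def G_def by auto
    thus ?thesis unfolding g_def using k'_le[OF that(1)]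
      by (meson add_left_mono ereal_less_eq(3) order_trans)
  qed
  hence "b \<in> K" using gb b by (meson not_le)
  then obtain a where a: "a \<in> K" "\<And>x. x \<in> K \<Longrightarrow> g x \<le> g a"
    using usc_on_attains_max[OF g_usc K K_sub] by blast
  have a_ball: "a \<in> ball 0 1" using a K_sub by blast
  have ga: "g a > 0" using a(2)[OF \<open>b \<in> K\<close>] gb by simp
  have g_le: "g z \<le> g a" if "z \<in> ball 0 1" for z
    using a(2) outside[OF that] ga by (meson less_imp_le order_trans)
  \<comment> \<open>At the maximum \<open>v\<close> is finite: \<open>v a = -\<infinity>\<close>
    would give \<open>g a = -\<infinity>\<close>, but \<open>g a > 0\<close>.\<close>
  obtain w where w: "v a = ereal (- w)"
  proof -
    obtain u where "v a = ereal u"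
      using ga v(2)[OF a_ball] unfolding g_def by (cases "v a") auto
    thus ?thesis using that[of "- u"] by simp
  qed
  have w0: "w \<ge> 0" using v(2)[OF a_ball] w by simp
  define s where "s = k' a - w"
  have ga_s: "g a = ereal s" by (simp add: g_def w s_def)
  obtain r where r: "r > 0" "cball a r \<subseteq> ball 0 1"
    using a_ball open_contains_cball[of "ball 0 1 :: complex set"] by (metis open_ball)
  define c where "c t = a + of_real r * cis t" for t
  have c: "c t \<in> ball 0 1" for t
    unfolding c_def by (rule cball_subset_unit_ballD[OF r(2,1)])
  have c_cont: "continuous_on A c" for A unfolding c_def by (intro continuous_intros)
  have int_k: "set_integrable lborel {0..2*pi} (\<lambda>t. k (c t))"
    using c by (intro borel_integrable_atLeastAtMost' continuous_on_compose2[OF k c_cont]) auto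
  have int_k': "set_integrable lborel {0..2*pi} (\<lambda>t. k' (c t) - s)"
    using c by (intro borel_integrable_atLeastAtMost' continuous_intros continuous_on_compose2[OF k'_cont c_cont]) auto
  have int_n: "set_integrable lborel {0..2*pi} (\<lambda>t. (norm (c t))\<^sup>2)"
    by (intro borel_integrable_atLeastAtMost' continuous_intros c_cont)
  have int_c: "set_integrable lborel {0..2*pi} (\<lambda>t. x :: real)" for x
    by (intro borel_integrable_atLeastAtMost' continuous_intros)
  \<comment> \<open>Since \<open>g \<le> s\<close>, the difference \<open>k' - s\<close> is at most
    \<open>- v\<close> on the circle. Its mean is \<open>w + q * r\<^sup>2\<close>, the excess
    coming from the square of the norm, while the mean of \<open>- v\<close> is at most
    \<open>w\<close>.\<close>
  have "(LINT t:{0..2*pi}|lborel. k' (c t) - s)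
      = (LINT t:{0..2*pi}|lborel. k (c t) + (q * (norm (c t))\<^sup>2 + (- q - s)))"
    by (simp add: k'_def algebra_simps)
  also have "\<dots> = (LINT t:{0..2*pi}|lborel. k (c t)) + (q * (LINT t:{0..2*pi}|lborel. (norm (c t))\<^sup>2)
       + (LINT t:{0..2*pi}|lborel. - q - s))"
    using int_k int_n int_c by (simp add: set_integral_add)
  also have "(LINT t:{0..2*pi}|lborel. - q - s) = 2 * pi * (- q - s)"
    by (simp add: set_lebesgue_integral_def)
  also have "(LINT t:{0..2*pi}|lborel. k (c t)) + (q * (LINT t:{0..2*pi}|lborel. (norm (c t))\<^sup>2)
        + 2 * pi * (- q - s)) = 2 * pi * (w + q * r\<^sup>2)"
    using mean[OF r] integral_norm_power2_circle[OF r(1), of a] unfolding c_def[symmetric]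
    by (simp add: s_def k'_def algebra_simps)
  finally have int_eq: "(LINT t:{0..2*pi}|lborel. k' (c t) - s) = 2 * pi * (w + q * r\<^sup>2)" .
  have "ennreal (2 * pi * (w + q * r\<^sup>2)) \<le> (\<integral>\<^sup>+t. ennreal (indicator {0..2*pi} t *\<^sub>R (k' (c t) - s)) \<partial>lborel)"
    using ennreal_integral_le_nn_integral[OF int_k'[unfolded set_integrable_def]] int_eq
    by (simp add: set_lebesgue_integral_def)
  also have "\<dots> \<le> (\<integral>\<^sup>+t\<in>{0..2*pi}. e2ennreal (- v (c t)) \<partial>lborel)"
  proof (rule nn_integral_mono)
    fix t
    have "v (c t) + ereal (k' (c t)) \<le> ereal s" using g_le[OF c, of t] ga_s by (simp add: g_def)
    hence "ereal (k' (c t) - s) \<le> - v (c t)"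
      by (cases "v (c t)") auto
    hence "ennreal (k' (c t) - s) \<le> e2ennreal (- v (c t))"
      using e2ennreal_mono by fastforce
    thus "ennreal (indicator {0..2*pi} t *\<^sub>R (k' (c t) - s)) \<le> e2ennreal (- v (c t)) * indicator {0..2*pi} t"
      by (simp add: indicator_def)
  qed
  finally have "enn2ereal (ennreal (2 * pi * (w + q * r\<^sup>2)))
      \<le> enn2ereal (\<integral>\<^sup>+t\<in>{0..2*pi}. e2ennreal (- v (c t)) \<partial>lborel)"
    by (simp add: less_eq_ennreal.rep_eq)
  also have "\<dots> \<le> ereal (2 * pi) * (- v a)"
    unfolding c_def by (rule subharmonic_nonpos_mean[OF v r])
  finally have "2 * pi * (w + q * r\<^sup>2) \<le> 2 * pi * w"
    using w w0 q r by (simp add: enn2ereal_ennreal)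
  hence "w + q * r\<^sup>2 \<le> w" by (subst (asm) mult_le_cancel_left_pos) auto
  thus False using mult_pos_pos[OF q(1), of "r\<^sup>2"] r by simp
qed

subsection \<open>Boundary pluripolar sets are null\<close>

lemma measurable_cis_sphere:
  "cis \<in> measurable (restrict_space lborel {0..<2*pi}) (restrict_space borel (sphere 0 1))"
  by (intro measurable_restrict_space3) (auto intro!: borel_measurable_continuous_onI continuous_intros)

text \<open>A two-constant estimate: with \<open>h\<close> the Poisson mass of \<open>T\<close>, the
  function \<open>v + M * h - M * e\<close> is nonpositive near the circle, because
  \<open>v \<le> - M\<close> and \<open>h \<le> 1\<close> inside \<open>U\<close>, while
  \<open>h \<le> e\<close> near circle points off \<open>U\<close>. Evaluation at \<open>a\<close>
  and the lower bound for \<open>h a\<close> finish the argument.\<close>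

lemma angle_measure_le:
  assumes v: "subharmonic_on (ball 0 1) v" "\<And>z. z \<in> ball 0 1 \<Longrightarrow> v z \<le> 0"
    and a: "a \<in> ball 0 1" "v a = ereal (- w)"
    and M: "M > 0" and U: "open U" "\<And>z. z \<in> U \<inter> ball 0 1 \<Longrightarrow> v z \<le> ereal (- M)"
    and T: "compact T" "T \<subseteq> {0..2*pi}" "cis ` T \<subseteq> U"
  shows "M * (measure lborel T * ((1 - norm a) / (1 + norm a)) / (2 * pi)) \<le> w"
proof (rule field_le_epsilon)
  fix e' :: real assume "e' > 0"
  define e where "e = e' / M"
  have e: "e > 0" "M * e = e'" using \<open>e' > 0\<close> M by (auto simp: e_def)
  have "compact (cis ` T)" using T by (intro compact_continuous_image continuous_intros)
  moreover have "closed (sphere 0 1 - U)" using U by (intro closed_Diff) auto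
  moreover have "cis ` T \<inter> (sphere 0 1 - U) = {}" using T by auto
  ultimately obtain d where d: "d > 0" "\<And>t \<zeta>. t \<in> T \<Longrightarrow> \<zeta> \<in> sphere 0 1 - U \<Longrightarrow> d \<le> dist (cis t) \<zeta>"
    using separate_compact_closed[of "cis ` T" "sphere 0 1 - U"] by blast
  \<comment> \<open>With \<open>\<rho> \<le> d / 2\<close> every pole stays at distance at least
    \<open>d / 2\<close> from circle points off \<open>U\<close>. There the kernel is at most
    \<open>3 * \<rho> / (d / 2)\<^sup>2\<close>, which is at most \<open>e / 2\<close> once
    \<open>24 * \<rho> \<le> e * d\<^sup>2\<close>.\<close>
  define \<rho> where "\<rho> = min 1 (min (d / 2) (e * d\<^sup>2 / 24))"
  have \<rho>: "\<rho> > 0" "\<rho> \<le> 1" "\<rho> \<le> d / 2" "24 * \<rho> \<le> e * d\<^sup>2" using d e by (auto simp: \<rho>_def)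
  define R where "R = 1 + \<rho>"
  have R: "R > 1" using \<rho> by (simp add: R_def)
  define h where "h = poisson_mass R T"
  have h_cont: "continuous_on (cball 0 1) h"
    unfolding h_def by (rule continuous_on_poisson_mass[OF R T(1,2)])
  have h_small: "h \<zeta> \<le> e / 2" if \<zeta>: "\<zeta> \<in> sphere 0 1 - U" for \<zeta>
    unfolding h_def
  proof (rule poisson_mass_upper[OF R T(1,2)])
    show "norm \<zeta> < R" using \<zeta> R by auto
    fix t assume "t \<in> T"
    have "d \<le> norm (cis t - \<zeta>)" using d(2)[OF \<open>t \<in> T\<close> \<zeta>] by (simp add: dist_norm)
    also have "cis t - \<zeta> = (of_real R * cis t - \<zeta>) - of_real \<rho> * cis t"
      by (simp add: R_def algebra_simps)
    also have "norm \<dots> \<le> norm (of_real R * cis t - \<zeta>) + \<rho>"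
      using norm_triangle_ineq4[of "of_real R * cis t - \<zeta>" "of_real \<rho> * cis t"] \<rho> by (simp add: norm_mult)
    finally have "d / 2 \<le> norm (of_real R * cis t - \<zeta>)" using \<rho> by linarith
    hence "(d / 2)\<^sup>2 \<le> (norm (of_real R * cis t - \<zeta>))\<^sup>2" using d by (intro power_mono) auto
    hence "poisson R t \<zeta> \<le> (R\<^sup>2 - 1) / (d / 2)\<^sup>2"
      unfolding poisson_eq using \<zeta> R d
      by (auto intro!: divide_left_mono mult_pos_pos zero_less_power simp: dest: less_le_trans[of 0 "(d/2)\<^sup>2"])
    also have "R\<^sup>2 - 1 = \<rho> * (2 + \<rho>)" by (simp add: R_def power2_eq_square algebra_simps)
    also have "\<dots> \<le> \<rho> * 3" using \<rho> by (intro mult_left_mono) auto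
    also have "\<rho> * 3 \<le> e * d\<^sup>2 / 8" using \<rho> by simp
    also have "(e * d\<^sup>2 / 8) / (d / 2)\<^sup>2 = e / 2" using d by (simp add: power2_eq_square)
    finally show "poisson R t \<zeta> \<le> e / 2" by (simp add: divide_right_mono)
  qed (use e in auto)
  define k where "k z = M * h z - M * e" for z
  have k_cont: "continuous_on (ball 0 1) k"
    unfolding k_def by (intro continuous_intros continuous_on_subset[OF h_cont]) auto
  have "v a + ereal (k a) \<le> 0"
  proof (rule subharmonic_maximum_principle[OF v k_cont _ _ a(1)])
    fix b :: complex and r :: real assume r: "r > 0" "cball b r \<subseteq> ball 0 1"
    have "continuous_on {0..2*pi} (\<lambda>s. h (b + of_real r * cis s))"
      using cball_subset_unit_ballD(1)[OF r(2,1)]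
      by (intro continuous_on_compose2[OF h_cont] continuous_intros) (auto simp: less_imp_le)
    hence "set_integrable lborel {0..2*pi} (\<lambda>s. h (b + of_real r * cis s))"
      by (rule borel_integrable_atLeastAtMost')
    moreover have "set_integrable lborel {0..2*pi} (\<lambda>s. M * e)"
      by (intro borel_integrable_atLeastAtMost' continuous_intros)
    ultimately have "(LINT s:{0..2*pi}|lborel. k (b + of_real r * cis s))
        = M * (LINT s:{0..2*pi}|lborel. h (b + of_real r * cis s)) - (LINT s:{0..2*pi}|lborel. M * e)"
      unfolding k_def by (simp add: set_integral_diff)
    also have "(LINT s:{0..2*pi}|lborel. M * e) = 2 * pi * (M * e)"
      by (simp add: set_lebesgue_integral_def)
    finally show "(LINT s:{0..2*pi}|lborel. k (b + of_real r * cis s)) = 2 * pi * k b"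
      using poisson_mass_mean[OF R T(1,2) r(2,1)] by (simp add: h_def k_def algebra_simps)
  next
    fix \<zeta> :: complex assume \<zeta>: "\<zeta> \<in> sphere 0 1"
    show "\<exists>N. open N \<and> \<zeta> \<in> N \<and> (\<forall>z\<in>N \<inter> ball 0 1. v z + ereal (k z) \<le> 0)"
    proof (cases "\<zeta> \<in> U")
      case True
      have "v z + ereal (k z) \<le> 0" if z: "z \<in> U \<inter> ball 0 1" for z
      proof -
        have "h z \<le> 1" unfolding h_def using z R by (intro poisson_mass_le_1[OF R T(1,2)]) auto
        hence "M * h z \<le> M * 1" using M by (intro mult_left_mono) auto
        hence "k z \<le> M" using e \<open>e' > 0\<close> by (simp add: k_def)
        thus ?thesis using U(2)[OF z] by (cases "v z") auto
      qed
      thus ?thesis using True U(1) by blast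
    next
      case False
      \<comment> \<open>Half of \<open>e\<close> is the bound for \<open>h\<close> at the boundary
        point; continuity up to the circle spends the other half.\<close>
      from h_cont \<zeta> e obtain \<delta> where \<delta>: "\<delta> > 0"
          "\<And>z. z \<in> cball 0 1 \<Longrightarrow> dist z \<zeta> < \<delta> \<Longrightarrow> dist (h z) (h \<zeta>) < e / 2"
        unfolding continuous_on_iff by (metis half_gt_zero mem_cball mem_sphere order_refl)
      have "v z + ereal (k z) \<le> 0" if z: "z \<in> ball \<zeta> \<delta> \<inter> ball 0 1" for z
      proof -
        have "dist (h z) (h \<zeta>) < e / 2" using \<delta>(2)[of z] z by (simp add: dist_commute)
        moreover have "h \<zeta> \<le> e / 2" using h_small \<zeta> False by blast
        ultimately have "h z \<le> e" unfolding dist_real_def by linarith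
        hence "k z \<le> 0" using M by (simp add: k_def)
        thus ?thesis using v(2)[of z] z by (cases "v z") auto
      qed
      thus ?thesis using \<delta>(1) by (intro exI[of _ "ball \<zeta> \<delta>"]) auto
    qed
  qed
  hence "M * h a \<le> w + e'" using a(2) e by (simp add: k_def)
  moreover have "measure lborel T * ((1 - norm a) / (1 + norm a)) / (2 * pi) \<le> h a"
    unfolding h_def using a(1) by (intro poisson_mass_lower[OF R T(1,2)]) auto
  ultimately show "M * (measure lborel T * ((1 - norm a) / (1 + norm a)) / (2 * pi)) \<le> w + e'"
    using M by (meson mult_left_mono less_imp_le order_trans)
qed

lemma b_pluripolar_imp_null:
  assumes "b_pluripolar (ball 0 1) F"
  shows "F \<in> null_sets circle_lebesgue"
proof -
  from assms obtain v a where F: "F \<subseteq> sphere 0 1"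
    and v: "subharmonic_on (ball 0 1) v" "\<And>z. z \<in> ball 0 1 \<Longrightarrow> v z \<le> 0"
    and a: "a \<in> ball 0 1" "v a \<noteq> -\<infinity>"
    and lim: "\<And>\<zeta>. \<zeta> \<in> F \<Longrightarrow> Limsup (at \<zeta> within ball 0 1) v = -\<infinity>"
    unfolding b_pluripolar_def by (auto simp: frontier_ball)
  obtain u where "v a = ereal u" using a v(2)[OF a(1)] by (cases "v a") auto
  then obtain w where w: "v a = ereal (- w)" by (metis minus_minus)
  define q where "q = (1 - norm a) / (1 + norm a) / (2 * pi)"
  have q: "q > 0" using a(1) unfolding q_def by (intro divide_pos_pos) (auto simp: add_pos_nonneg)
  \<comment> \<open>The largest open set on whose part in the disk \<open>v \<le> - (n + 1)\<close>;
    the successor keeps the level \<open>M\<close> positive.\<close>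
  define U where "U n = \<Union>{N. open N \<and> (\<forall>z\<in>N \<inter> ball 0 1. v z \<le> ereal (- real (Suc n)))}" for n
  have U_open: "open (U n)" for n unfolding U_def by (intro open_Union) auto
  have U_le: "v z \<le> ereal (- real (Suc n))" if "z \<in> U n \<inter> ball 0 1" for z n
    using that unfolding U_def by blast
  have F_U: "F \<subseteq> U n" for n
  proof
    fix \<zeta> assume \<zeta>: "\<zeta> \<in> F"
    have "eventually (\<lambda>z. v z < ereal (- real (Suc n))) (at \<zeta> within ball 0 1)"
      using lim[OF \<zeta>] Limsup_le_iff[of "at \<zeta> within ball 0 1" v "-\<infinity>"] by auto
    then obtain N where "open N" "\<zeta> \<in> N"
      "\<And>z. z \<in> N \<Longrightarrow> z \<noteq> \<zeta> \<Longrightarrow> z \<in> ball 0 1 \<Longrightarrow> v z < ereal (- real (Suc n))"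
      unfolding eventually_at_topological by metis
    \<comment> \<open>The limsup ignores the point \<open>\<zeta>\<close> itself, which is harmless
      because it lies off the open disk.\<close>
    moreover have "\<zeta> \<notin> ball 0 1" using F \<zeta> by auto
    ultimately show "\<zeta> \<in> U n" unfolding U_def by (blast intro: less_imp_le)
  qed
  define A where "A n = cis -` U n \<inter> {0..<2*pi}" for n
  have "open (cis -` U n)" for n
    by (intro open_vimage U_open continuous_intros)
  hence A_borel: "A n \<in> sets borel" for n unfolding A_def by (intro sets.Int) auto
  have A_le: "emeasure lborel (A n) \<le> ennreal (w / q / real (Suc n))" for n
  proof (rule ennreal_le_epsilon)
    fix e :: real assume e: "e > 0"
    \<comment> \<open>The estimate concerns compact sets of angles, so \<open>A n\<close> is
      exhausted from inside up to measure \<open>e\<close>.\<close>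
    obtain T where T: "closed T" "T \<subseteq> A n" "emeasure lebesgue (A n - T) < ennreal e"
      using sets_lebesgue_inner_closed[of "A n" e] A_borel[of n] e by (metis sets_completionI_sets sets_lborel)
    have T_sub: "T \<subseteq> {0..2*pi}" using T(2) by (auto simp: A_def)
    have T_comp: "compact T" using T(1) T_sub by (metis compact_Icc compact_Int_closed inf.absorb_iff2)
    have T_borel: "T \<in> sets borel" using T by simp
    have "real (Suc n) * (measure lborel T * ((1 - norm a) / (1 + norm a)) / (2 * pi)) \<le> w"
      using T(2) by (intro angle_measure_le[OF v a(1) w _ U_open U_le T_comp T_sub]) (auto simp: A_def)
    hence "real (Suc n) * (measure lborel T * q) \<le> w"
      by (simp only: q_def times_divide_eq_right)
    hence "measure lborel T \<le> w / q / real (Suc n)"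
      using q by (simp add: pos_le_divide_eq mult_ac del: of_nat_Suc)
    hence "emeasure lborel T \<le> ennreal (w / q / real (Suc n))"
      using emeasure_eq_ennreal_measure[of lborel T] emeasure_compact_finite[OF T_comp]
      by (metis ennreal_leI infinity_ennreal_def less_irrefl)
    moreover have "emeasure lborel (A n - T) \<le> ennreal e"
      using T(3) A_borel[of n] T_borel by simp
    moreover have "emeasure lborel (A n) \<le> emeasure lborel T + emeasure lborel (A n - T)"
      using emeasure_subadditive[of T lborel "A n - T"] A_borel[of n] T_borel T(2) by (simp add: Un_absorb1)
    ultimately show "emeasure lborel (A n) \<le> ennreal (w / q / real (Suc n)) + ennreal e"
      by (meson add_mono order_trans)
  qed
  \<comment> \<open>\<open>F\<close> need not be Borel; it is null in the completion because this
    Borel superset is null.\<close>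
  define B where "B = sphere 0 1 \<inter> (\<Inter>n. U n)"
  have B: "B \<in> sets (restrict_space borel (sphere 0 1))"
    unfolding B_def using U_open by (auto simp: sets_restrict_space image_iff intro!: sets.countable_INT'' exI[of _ "\<Inter>n. U n"] bexI[of _ "\<Inter>n. U n"])
  have "emeasure (distr (restrict_space lborel {0..<2*pi}) (restrict_space borel (sphere 0 1)) cis) B
      = emeasure lborel (cis -` B \<inter> {0..<2*pi})"
    using B measurable_cis_sphere by (simp add: emeasure_distr emeasure_restrict_space space_restrict_space)
  also have "\<dots> = 0"
  proof -
    have le: "emeasure lborel (cis -` B \<inter> {0..<2*pi}) \<le> ennreal (w / q / real (Suc n))" for n
    proof -
      have "emeasure lborel (cis -` B \<inter> {0..<2*pi}) \<le> emeasure lborel (A n)"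
        using A_borel[of n] by (intro emeasure_mono) (auto simp: A_def B_def)
      thus ?thesis using A_le order_trans by blast
    qed
    have "(\<lambda>n. w / q / real (Suc n)) \<longlonglongrightarrow> 0"
      by (rule LIMSEQ_Suc[OF lim_const_over_n])
    hence "(\<lambda>n. ennreal (w / q / real (Suc n))) \<longlonglongrightarrow> 0"
      using tendsto_ennrealI by fastforce
    from LIMSEQ_le_const[OF this] le show ?thesis by (metis le_zero_eq)
  qed
  finally have "B \<in> null_sets (distr (restrict_space lborel {0..<2*pi}) (restrict_space borel (sphere 0 1)) cis)"
    using B by (intro null_setsI) auto
  moreover have "F \<subseteq> B" using F F_U by (auto simp: B_def)
  ultimately show ?thesis
    unfolding circle_lebesgue_def null_sets_completion_iff2 by blast
qed

subsection \<open>Null sets are boundary pluripolar\<close>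

text \<open>The sum is a supremum of continuous partial sums, hence its negative is upper
  semicontinuous. Monotone convergence carries the mean value equality over to the sum, including
  points where it is infinite.\<close>

lemma subharmonic_on_neg_suminf:
  fixes h :: "nat \<Rightarrow> complex \<Rightarrow> real"
  assumes pos: "\<And>j z. z \<in> ball 0 1 \<Longrightarrow> h j z \<ge> 0"
    and cont: "\<And>j. continuous_on (ball 0 1) (h j)"
    and mean: "\<And>j a r. r > 0 \<Longrightarrow> cball a r \<subseteq> ball 0 1 \<Longrightarrow>
                 (LINT s:{0..2*pi}|lborel. h j (a + of_real r * cis s)) = 2 * pi * h j a"
  shows "subharmonic_on (ball 0 1) (\<lambda>z. - enn2ereal (\<Sum>j. ennreal (h j z)))"
proof -
  define W where "W z = (\<Sum>j. ennreal (h j z))" for z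
  have usc: "usc_on (ball 0 1) (\<lambda>z. - enn2ereal (W z))"
    unfolding usc_on_def
  proof
    fix c :: ereal
    show "openin (top_of_set (ball 0 1)) {z \<in> ball 0 1. - enn2ereal (W z) < c}"
    \<comment> \<open>For \<open>c \<le> 0\<close> the condition says that some partial sum exceeds
      \<open>- c\<close>, an open condition. For \<open>c > 0\<close> it holds everywhere, since the
      function is nonpositive.\<close>
    proof (cases "0 \<le> - c")
      case True
      have "- enn2ereal (W z) < c \<longleftrightarrow> (\<exists>n. e2ennreal (- c) < ennreal (\<Sum>j<n. h j z))" if z: "z \<in> ball 0 1" for z
      proof -
        have "- enn2ereal (W z) < c \<longleftrightarrow> - c < enn2ereal (W z)"
          by (rule ereal_uminus_less_reorder)
        also have "\<dots> \<longleftrightarrow> e2ennreal (- c) < W z"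
          using enn2ereal_Ioi[of "- c"] True by auto
        also have "\<dots> \<longleftrightarrow> (\<exists>n. e2ennreal (- c) < (\<Sum>j<n. ennreal (h j z)))"
          unfolding W_def suminf_eq_SUP less_SUP_iff by simp
        also have "\<dots> \<longleftrightarrow> (\<exists>n. e2ennreal (- c) < ennreal (\<Sum>j<n. h j z))"
          using pos[OF z] by (simp add: sum_ennreal)
        finally show ?thesis .
      qed
      hence "{z \<in> ball 0 1. - enn2ereal (W z) < c}
          = (\<Union>n. ball 0 1 \<inter> (\<lambda>z. ennreal (\<Sum>j<n. h j z)) -` {e2ennreal (- c)<..})"
        by auto
      moreover have "openin (top_of_set (ball 0 1)) (ball 0 1 \<inter> (\<lambda>z. ennreal (\<Sum>j<n. h j z)) -` {e2ennreal (- c)<..})" for n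
        by (intro continuous_openin_preimage_gen continuous_on_ennreal continuous_on_sum cont) auto
      ultimately show ?thesis by (simp only:) (intro openin_Union, auto)
    next
      case False
      hence "c > 0" by (cases c) auto
      hence "- enn2ereal (W z) < c" for z
        using enn2ereal_nonneg[of "W z"] by (metis ereal_uminus_le_0_iff le_less_trans)
      hence "{z \<in> ball 0 1. - enn2ereal (W z) < c} = ball 0 1" by blast
      thus ?thesis by simp
    qed
  qed
  have mean_W: "circle_mean (\<lambda>z. - enn2ereal (W z)) a r = - enn2ereal (W a)"
    if r: "r > 0" "cball a r \<subseteq> ball 0 1" for a r
  proof -
    define c where "c t = a + of_real r * cis t" for t
    have c: "c t \<in> ball 0 1" for t
      unfolding c_def by (rule cball_subset_unit_ballD[OF r(2,1)])
    have c_cont: "continuous_on A c" for A unfolding c_def by (intro continuous_intros)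
    have int: "set_integrable lborel {0..2*pi} (\<lambda>t. h j (c t))" for j
      using c by (intro borel_integrable_atLeastAtMost' continuous_on_compose2[OF cont c_cont]) auto
    have nn: "(\<integral>\<^sup>+t\<in>{0..2*pi}. ennreal (h j (c t)) \<partial>lborel) = ennreal (2 * pi) * ennreal (h j a)" for j
    proof -
      have "(\<integral>\<^sup>+t\<in>{0..2*pi}. ennreal (h j (c t)) \<partial>lborel)
          = (\<integral>\<^sup>+t. ennreal (indicator {0..2*pi} t *\<^sub>R h j (c t)) \<partial>lborel)"
        by (intro nn_integral_cong) (auto simp: indicator_def)
      also have "\<dots> = ennreal (LINT t:{0..2*pi}|lborel. h j (c t))"
        unfolding set_lebesgue_integral_def
        using int pos c by (intro nn_integral_eq_integral) (auto simp: set_integrable_def)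
      also have "(LINT t:{0..2*pi}|lborel. h j (c t)) = 2 * pi * h j a"
        unfolding c_def by (rule mean[OF r])
      finally show ?thesis using pos[OF cball_subset_unit_ballD(2)[OF r(2,1)], of j]
        by (simp only:) (subst ennreal_mult, auto)
    qed
    have "(\<integral>\<^sup>+t\<in>{0..2*pi}. W (c t) \<partial>lborel) = (\<integral>\<^sup>+t. (\<Sum>j. ennreal (indicator {0..2*pi} t *\<^sub>R h j (c t))) \<partial>lborel)"
      by (intro nn_integral_cong) (auto simp: W_def indicator_def)
    also have "\<dots> = (\<Sum>j. \<integral>\<^sup>+t. ennreal (indicator {0..2*pi} t *\<^sub>R h j (c t)) \<partial>lborel)"
      using int by (intro nn_integral_suminf) (auto simp: set_integrable_def dest: borel_measurable_integrable)
    also have "\<dots> = (\<Sum>j. \<integral>\<^sup>+t\<in>{0..2*pi}. ennreal (h j (c t)) \<partial>lborel)"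
      by (intro suminf_cong nn_integral_cong) (auto simp: indicator_def)
    also have "\<dots> = ennreal (2 * pi) * W a"
      unfolding nn W_def by simp
    finally have I: "(\<integral>\<^sup>+t\<in>{0..2*pi}. W (c t) \<partial>lborel) = ennreal (2 * pi) * W a" .
    have "circle_mean (\<lambda>z. - enn2ereal (W z)) a r = (0 - enn2ereal (ennreal (2 * pi) * W a)) / ereal (2 * pi)"
      using I by (simp add: circle_mean_def c_def[symmetric] e2ennreal_neg zero_ennreal.rep_eq)
    also have "\<dots> = - enn2ereal (W a)"
    proof (cases "W a")
      case (real x)
      thus ?thesis by (simp add: enn2ereal_ennreal flip: ennreal_mult)
    next
      case top
      thus ?thesis by (simp add: ennreal_mult_top)
    qed
    finally show ?thesis .
  qed
  show ?thesis
    unfolding subharmonic_on_def W_def[symmetric]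
  proof (intro conjI usc ballI allI impI)
    fix z show "- enn2ereal (W z) < \<infinity>"
      using enn2ereal_nonneg[of "W z"] by (cases "enn2ereal (W z)") auto
  qed (use mean_W in auto)
qed

section \<open>Covering null sets of angles by short intervals\<close>

text \<open>An open superset of \<open>N\<close> with measure at most \<open>e\<close> is found by
  outer regularity. The covering lemma, with a gauge tied to this set, supplies nonoverlapping
  closed intervals inside it, so their total length is at most \<open>e\<close>.\<close>

lemma null_set_interval_cover:
  fixes S :: "real set"
  assumes S: "S \<subseteq> {0..2*pi}" "S \<subseteq> N" "N \<in> null_sets lborel" and e: "e > 0"
  shows "\<exists>(t :: nat \<Rightarrow> real) d. (\<forall>j. d j \<ge> 0) \<and> (\<Sum>j. ennreal (d j)) \<le> ennreal e \<and>
           (\<forall>\<theta>\<in>S. \<exists>j. d j > 0 \<and> \<bar>\<theta> - t j\<bar> < d j)"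
proof -
  obtain U where U: "open U" "N \<subseteq> U" "emeasure lborel (U - N) < ennreal e"
    using outer_regular_lborel[of N e] S e by (auto simp: null_sets_def)
  have "emeasure lborel U \<le> emeasure lborel N + emeasure lborel (U - N)"
    using emeasure_subadditive[of N lborel "U - N"] U S by (simp add: null_sets_def Un_absorb1)
  hence U_small: "emeasure lborel U \<le> ennreal e"
    using S U by (auto simp: null_sets_def)
  define g where "g x = (if x \<in> U then U else UNIV)" for x
  have g: "gauge g" using U by (auto simp: gauge_def g_def)
  have box: "S \<subseteq> cbox 0 (2*pi)" "box 0 (2*pi) \<noteq> {}" using S pi_gt_zero by (auto simp del: pi_gt_zero)
  obtain \<D> where D: "countable \<D>" "\<Union>\<D> \<subseteq> cbox 0 (2*pi)"
    "\<And>K. K \<in> \<D> \<Longrightarrow> interior K \<noteq> {} \<and> (\<exists>c d. K = cbox c d)"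
    "pairwise (\<lambda>A B. interior A \<inter> interior B = {}) \<D>"
    "\<And>K. K \<in> \<D> \<Longrightarrow> \<exists>x \<in> S \<inter> K. K \<subseteq> g x"
    "\<And>u v. cbox u v \<in> \<D> \<Longrightarrow> \<exists>n. \<forall>i\<in>Basis. inner v i - inner u i = (inner (2*pi) i - inner 0 i) / 2^n"
    "S \<subseteq> \<Union>\<D>"
    by (rule covering_lemma[OF box g], rule that)
  have ex: "\<exists>l u. l < u \<and> K = {l..u}" if "K \<in> \<D>" for K
    using D(3)[OF that] by (auto simp: interior_cbox) (metis less_trans) 
  then obtain l u where lu: "\<And>K. K \<in> \<D> \<Longrightarrow> l K < u K" "\<And>K. K \<in> \<D> \<Longrightarrow> K = {l K..u K}"
    by metis
  \<comment> \<open>The family may be finite; indices outside \<open>J\<close> are padding and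
    receive length 0.\<close>
  define J where "J = to_nat_on \<D> ` \<D>"
  define K where "K j = from_nat_into \<D> j" for j
  have K: "K j \<in> \<D>" "to_nat_on \<D> (K j) = j" if "j \<in> J" for j
    using that D(1) by (auto simp: J_def K_def)
  define t where "t j = (l (K j) + u (K j)) / 2" for j
  \<comment> \<open>The full length, not half of it: the strict inequality then holds at the
    endpoints of the closed interval too.\<close>
  define d where "d j = (if j \<in> J then u (K j) - l (K j) else 0)" for j
  define I where "I j = (if j \<in> J then interior (K j) else {})" for j
  have I_eq: "I j = {l (K j)<..<u (K j)}" if "j \<in> J" for j
    using lu(2)[OF K(1)[OF that]] that unfolding I_def by (metis interior_atLeastAtMost_real)
  have d_nonneg: "d j \<ge> 0" for j using lu(1)[OF K(1)] by (auto simp: d_def less_imp_le)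
  have "ennreal (d j) = emeasure lborel (I j)" for j
  proof (cases "j \<in> J")
    case True
    thus ?thesis using lu(1)[OF K(1)[OF True]] by (simp add: I_eq d_def)
  qed (simp add: d_def I_def)
  hence "(\<Sum>j. ennreal (d j)) = (\<Sum>j. emeasure lborel (I j))" by simp
  also have "\<dots> = emeasure lborel (\<Union>j. I j)"
  proof (rule suminf_emeasure)
    show "range I \<subseteq> sets lborel" by (auto simp: I_def)
    show "disjoint_family I"
      unfolding disjoint_family_on_def
    proof (intro ballI impI)
      fix i j :: nat assume "i \<noteq> j"
      show "I i \<inter> I j = {}"
      proof (cases "i \<in> J \<and> j \<in> J")
        case True
        hence "K i \<noteq> K j" using K(2) \<open>i \<noteq> j\<close> by metis
        thus ?thesis using D(4) K(1) True by (auto simp: I_def pairwise_def)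
      qed (auto simp: I_def)
    qed
  qed
  also have "\<dots> \<le> emeasure lborel U"
  proof (rule emeasure_mono)
    have "K j \<subseteq> U" if "j \<in> J" for j
    proof -
      from D(5)[OF K(1)[OF that]] obtain x where "x \<in> S" "K j \<subseteq> g x" by blast
      moreover have "x \<in> U" using \<open>x \<in> S\<close> S U by blast
      ultimately show ?thesis by (simp add: g_def)
    qed
    thus "(\<Union>j. I j) \<subseteq> U" unfolding I_def using interior_subset by (auto split: if_splits)
  qed (use U in auto)
  finally have "(\<Sum>j. ennreal (d j)) \<le> ennreal e" using U_small by simp
  moreover have "\<exists>j. d j > 0 \<and> \<bar>\<theta> - t j\<bar> < d j" if "\<theta> \<in> S" for \<theta>
  proof -
    from that D(7) obtain L where L: "L \<in> \<D>" "\<theta> \<in> L" by blast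
    define j where "j = to_nat_on \<D> L"
    have j: "j \<in> J" "K j = L" using L(1) D(1) by (auto simp: j_def J_def K_def)
    have "l L < u L" "\<theta> \<in> {l L..u L}" using lu L by auto
    hence "d j > 0 \<and> \<bar>\<theta> - t j\<bar> < d j"
      using j by (auto simp: d_def t_def abs_if field_simps)
    thus ?thesis by blast
  qed
  ultimately show ?thesis using d_nonneg by blast
qed

text \<open>Covers of total length at most \<open>(1/2)^n\<close>, one for each \<open>n\<close>,
  are merged into a single sequence by the pairing function. Each point picks an interval from every
  cover, hence infinitely many indices.\<close>

lemma null_set_interval_cover_infinite:
  fixes S :: "real set"
  assumes S: "S \<subseteq> {0..2*pi}" "S \<subseteq> N" "N \<in> null_sets lborel"
  obtains t d :: "nat \<Rightarrow> real" where "\<And>j. d j \<ge> 0" "(\<Sum>j. ennreal (d j)) < top"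
    "\<And>\<theta>. \<theta> \<in> S \<Longrightarrow> infinite {j. d j > 0 \<and> \<bar>\<theta> - t j\<bar> < d j}"
proof -
  have "\<forall>n. \<exists>(t :: nat \<Rightarrow> real) d. (\<forall>j. d j \<ge> 0) \<and> (\<Sum>j. ennreal (d j)) \<le> ennreal ((1/2)^n) \<and>
           (\<forall>\<theta>\<in>S. \<exists>j. d j > 0 \<and> \<bar>\<theta> - t j\<bar> < d j)"
    by (intro allI null_set_interval_cover[OF S]) simp
  then obtain t d :: "nat \<Rightarrow> nat \<Rightarrow> real" where td: "\<And>n j. d n j \<ge> 0"
      "\<And>n. (\<Sum>j. ennreal (d n j)) \<le> ennreal ((1/2)^n)"
      "\<And>n \<theta>. \<theta> \<in> S \<Longrightarrow> \<exists>j. d n j > 0 \<and> \<bar>\<theta> - t n j\<bar> < d n j"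
    by metis
  define t' where "t' j = (case prod_decode j of (n, i) \<Rightarrow> t n i)" for j
  define d' where "d' j = (case prod_decode j of (n, i) \<Rightarrow> d n i)" for j
  show ?thesis
  proof (rule that[of d' t'])
    show "d' j \<ge> 0" for j using td(1) by (simp add: d'_def split: prod.splits)
    have "(\<Sum>j. ennreal (d' j)) = (\<Sum>j. (\<lambda>(n, i). ennreal (d n i)) (prod_decode j))"
      by (intro suminf_cong) (simp add: d'_def split: prod.splits)
    also have "\<dots> = (\<Sum>n. \<Sum>i. ennreal (d n i))"
      using suminf_ennreal_2dimen[of "\<lambda>n. \<Sum>i. ennreal (d n i)" "\<lambda>(n, i). ennreal (d n i)"] by simp
    also have "\<dots> \<le> (\<Sum>n. ennreal ((1/2)^n))"
      by (rule suminf_le[OF td(2) summableI summableI])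
    also have "\<dots> < top"
    proof -
      have "summable (\<lambda>n. (1/2 :: real)^n)" by (rule summable_geometric) simp
      hence "(\<Sum>n. ennreal ((1/2)^n)) \<noteq> top" by (rule ennreal_suminf_neq_top) simp
      thus ?thesis by (rule top.not_eq_extremum[THEN iffD1])
    qed
    finally show "(\<Sum>j. ennreal (d' j)) < top" .
    fix \<theta> assume "\<theta> \<in> S"
    then obtain i where i: "\<And>n. d n (i n) > 0 \<and> \<bar>\<theta> - t n (i n)\<bar> < d n (i n)"
      using td(3) by metis
    have "inj (\<lambda>n. prod_encode (n, i n))"
      by (rule injI) (simp add: inj_eq[OF inj_prod_encode])
    hence "infinite (range (\<lambda>n. prod_encode (n, i n)))"
      by (rule range_inj_infinite)
    moreover have "range (\<lambda>n. prod_encode (n, i n)) \<subseteq> {j. d' j > 0 \<and> \<bar>\<theta> - t' j\<bar> < d' j}"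
      using i by (auto simp: d'_def t'_def)
    ultimately show "infinite {j. d' j > 0 \<and> \<bar>\<theta> - t' j\<bar> < d' j}"
      using finite_subset by blast
  qed
qed

section \<open>Kernels attached to the intervals and their sum\<close>

text \<open>A chord is no longer than its arc: the chord has length
  \<open>2 * \<bar>sin ((x - y) / 2)\<bar>\<close>.\<close>

lemma norm_cis_diff_le: "norm (cis x - cis y) \<le> \<bar>x - y\<bar>"
proof -
  have "cis x - cis y = cis y * (cis (x - y) - 1)" by (simp add: algebra_simps cis_mult)
  hence "norm (cis x - cis y) = norm (cis (x - y) - 1)" by (simp add: norm_mult)
  also have "\<dots> \<le> \<bar>x - y\<bar>"
    using dist_exp_i_1[of "x - y"] abs_sin_x_le_abs_x[of "(x - y) / 2"] by (simp add: cis_conv_exp)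
  finally show ?thesis .
qed

text \<open>The pole is within \<open>d + d\<close> of \<open>cis \<theta>\<close>, and the
  numerator of the kernel is \<open>2 * d + d\<^sup>2\<close>. The scaled kernel is therefore at
  least \<open>2 + d\<close>.\<close>

lemma poisson_large_near_pole:
  assumes "d > 0" "\<bar>\<theta> - t\<bar> < d"
  shows "4 * d * poisson (1 + d) t (cis \<theta>) > 1"
proof -
  define D where "D = norm (of_real (1 + d) * cis t - cis \<theta>)"
  have "of_real (1 + d) * cis t - cis \<theta> = (cis t - cis \<theta>) + of_real d * cis t"
    by (simp add: algebra_simps)
  hence "D \<le> norm (cis t - cis \<theta>) + norm (of_real d * cis t)"
    unfolding D_def by (metis norm_triangle_ineq)
  hence "D \<le> 2 * d" using norm_cis_diff_le[of t \<theta>] assms by (simp add: norm_mult)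
  moreover have "D > 0"
    unfolding D_def using poisson_denominator_nz[of "cis \<theta>" "1 + d" t] assms by simp
  ultimately have D: "0 < D\<^sup>2" "D\<^sup>2 \<le> (2 * d)\<^sup>2"
    using power_mono[of D "2 * d" 2] by simp_all
  have "D\<^sup>2 < 4 * d * (2 * d + d\<^sup>2)"
  proof -
    have "4 * d * (2 * d + d\<^sup>2) = (2 * d)\<^sup>2 + 4 * d\<^sup>2 * (1 + d)"
      by (simp add: power2_eq_square algebra_simps)
    moreover have "4 * d\<^sup>2 * (1 + d) > 0" using assms by (intro mult_pos_pos) auto
    ultimately show ?thesis using D(2) by linarith
  qed
  moreover have "4 * d * poisson (1 + d) t (cis \<theta>) = 4 * d * (2 * d + d\<^sup>2) / D\<^sup>2"
    unfolding poisson_eq D_def by (simp add: power2_eq_square algebra_simps)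
  ultimately show ?thesis using D(1) by simp
qed

lemma null_imp_b_pluripolar:
  assumes F: "F \<in> null_sets circle_lebesgue" "F \<subseteq> sphere 0 1"
  shows "b_pluripolar (ball 0 1) F"
proof -
  let ?M = "distr (restrict_space lborel {0..<2*pi}) (restrict_space borel (sphere 0 1)) cis"
  from F(1) obtain B where B: "B \<in> null_sets ?M" "F \<subseteq> B"
    unfolding circle_lebesgue_def null_sets_completion_iff2 by blast
  define N where "N = cis -` B \<inter> {0..<2*pi}"
  have B_sets: "B \<in> sets (restrict_space borel (sphere 0 1))" using B by (auto simp: null_sets_def)
  have N_sets: "N \<in> sets (restrict_space lborel {0..<2*pi})"
    using measurable_sets[OF measurable_cis_sphere B_sets] by (simp add: N_def space_restrict_space)
  have "emeasure lborel N = emeasure ?M B"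
    using B_sets measurable_cis_sphere by (simp add: emeasure_distr emeasure_restrict_space space_restrict_space N_def)
  hence N: "N \<in> null_sets lborel"
    using B N_sets by (auto simp: null_sets_def sets_restrict_space_iff)
  define S where "S = cis -` F \<inter> {0..<2*pi}"
  have "S \<subseteq> {0..2*pi}" "S \<subseteq> N" using B by (auto simp: S_def N_def)
  then obtain t d :: "nat \<Rightarrow> real" where d: "\<And>j. d j \<ge> 0" "(\<Sum>j. ennreal (d j)) < top"
    and inf: "\<And>\<theta>. \<theta> \<in> S \<Longrightarrow> infinite {j. d j > 0 \<and> \<bar>\<theta> - t j\<bar> < d j}"
    using null_set_interval_cover_infinite[OF _ _ N] by metis
  define h where "h j z = 4 * d j * poisson (1 + d j) (t j) z" for j z
  \<comment> \<open>For \<open>d j > 0\<close> the pole lies strictly outside the closed disk, so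
    continuity reaches the circle. Padding indices have scale factor 0.\<close>
  have h_cont: "continuous_on (cball 0 1) (h j)" if "d j > 0" for j
    unfolding h_def using that by (intro continuous_intros continuous_on_poisson) auto
  have h_cont': "continuous_on (ball 0 1) (h j)" for j
    unfolding h_def using d(1)[of j] by (intro continuous_intros continuous_on_poisson) auto
  have h_pos: "h j z \<ge> 0" if "z \<in> ball 0 1" for j z
    unfolding h_def using d(1)[of j] poisson_pos[of z "1 + d j" "t j"] that by simp
  define W where "W z = (\<Sum>j. ennreal (h j z))" for z
  have "subharmonic_on (ball 0 1) (\<lambda>z. - enn2ereal (W z))"
    unfolding W_def
  proof (rule subharmonic_on_neg_suminf[OF h_pos h_cont'])
    fix j a and r :: real assume r: "r > 0" "cball a r \<subseteq> ball (0::complex) 1"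
    show "(LINT s:{0..2*pi}|lborel. h j (a + of_real r * cis s)) = 2 * pi * h j a"
      using poisson_mean[OF r(2,1), of "1 + d j" "t j"] d(1)[of j] by (simp add: h_def)
  qed
  moreover have "- enn2ereal (W 0) \<noteq> -\<infinity>"
  proof -
    have "ennreal (h j 0) = 4 * ennreal (d j)" for j
      using d(1)[of j] by (simp add: h_def poisson_0 ennreal_mult)
    hence "W 0 = 4 * (\<Sum>j. ennreal (d j))" by (simp add: W_def)
    also have "\<dots> < top" using d(2) by (simp add: ennreal_mult_less_top)
    finally show ?thesis by (cases "W 0") auto
  qed
  moreover have "Limsup (at \<zeta> within ball 0 1) (\<lambda>z. - enn2ereal (W z)) = -\<infinity>" if "\<zeta> \<in> F" for \<zeta>
  proof (rule ereal_bot)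
    fix b :: real
    have "norm \<zeta> = 1" using that F by auto
    then obtain \<theta> where \<theta>: "\<zeta> = cis \<theta>" "0 \<le> \<theta>" "\<theta> < 2 * pi"
      using complex_unimodular_polar[of \<zeta>] by (metis cis.code)
    hence "\<theta> \<in> S" using that by (simp add: S_def)
    \<comment> \<open>Any \<open>n\<close> of the infinitely many kernels push the sum above
      \<open>n\<close>; being finitely many, they all exceed 1 on one common neighbourhood of
      \<open>\<zeta>\<close> in the disk.\<close>
    obtain n where n: "- b \<le> real n" using real_arch_simple by blast
    obtain J where J: "finite J" "card J = n" "J \<subseteq> {j. d j > 0 \<and> \<bar>\<theta> - t j\<bar> < d j}"
      using infinite_arbitrarily_large[OF inf[OF \<open>\<theta> \<in> S\<close>]] by blast
    have "eventually (\<lambda>z. h j z > 1) (at \<zeta> within ball 0 1)" if "j \<in> J" for j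
    proof -
      have j: "d j > 0" "\<bar>\<theta> - t j\<bar> < d j" using J that by auto
      have "(h j \<longlongrightarrow> h j \<zeta>) (at \<zeta> within cball 0 1)"
        using h_cont[OF j(1)] \<open>norm \<zeta> = 1\<close> by (auto simp: continuous_on_def)
      hence "(h j \<longlongrightarrow> h j \<zeta>) (at \<zeta> within ball 0 1)"
        by (rule tendsto_within_subset) auto
      moreover have "h j \<zeta> > 1" using poisson_large_near_pole[OF j] by (simp add: h_def \<theta>)
      ultimately show ?thesis by (rule order_tendstoD)
    qed
    hence "eventually (\<lambda>z. \<forall>j\<in>J. h j z > 1) (at \<zeta> within ball 0 1)"
      using J(1) by (intro eventually_ball_finite) auto
    hence "eventually (\<lambda>z. - enn2ereal (W z) \<le> ereal b) (at \<zeta> within ball 0 1)"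
    proof eventually_elim
      case (elim z)
      have "ennreal (real n) = (\<Sum>j\<in>J. ennreal 1)" using J(2) by (simp add: ennreal_of_nat_eq_real_of_nat)
      also have "\<dots> \<le> (\<Sum>j\<in>J. ennreal (h j z))"
        using elim by (intro sum_mono ennreal_leI) auto
      also have "\<dots> \<le> W z"
        unfolding W_def using J(1) by (intro sum_le_suminf) auto
      finally have "ereal (real n) \<le> enn2ereal (W z)"
        by (simp add: less_eq_ennreal.rep_eq)
      hence "- enn2ereal (W z) \<le> - ereal (real n)" by (simp only: ereal_minus_le_minus)
      also have "\<dots> \<le> ereal b" using n by simp
      finally show ?case .
    qed
    thus "Limsup (at \<zeta> within ball 0 1) (\<lambda>z. - enn2ereal (W z)) \<le> ereal b"
      by (rule Limsup_bounded)
  qed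
  ultimately show ?thesis
    unfolding b_pluripolar_def using F(2)
    by (intro conjI exI[of _ "\<lambda>z. - enn2ereal (W z)"] bexI[of _ 0]) (auto simp: frontier_ball)
qed

theorem mainTheorem5:
  fixes \<phi> :: "complex \<Rightarrow> real"
  assumes "bounded (\<phi> ` sphere 0 1)"
  shows "discontinuities (sphere 0 1) \<phi> \<in> null_sets circle_lebesgue \<longleftrightarrow>
         b_pluripolar (ball 0 1) (discontinuities (sphere 0 1) \<phi>)"
proof -
  have "discontinuities (sphere 0 1) \<phi> \<subseteq> sphere 0 1"
    by (auto simp: discontinuities_def)
  thus ?thesis
    using null_imp_b_pluripolar b_pluripolar_imp_null by blast
qed

end
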